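(* Let $0<\lambda\le\pi/2$, and let $f\in\mathcal{S}^*_{\lambda e}$ and $g\in\mathcal{C}_{\lambda e}$ be related by $g=J[f]$. Then the pre-Schwarzian norm satisfies $$\|P_g\|=\|P_{J[f]}\|\le\frac{(1-\alpha^2)(e^{\lambda\alpha}-1)}{\alpha},$$ where $\alpha$ is the unique root in $(0,1)$ of the equation $$\lambda re^{\lambda r}(1-r^2)-(1+r^2)(e^{\lambda r}-1)=0.$$ The inequality is sharp, i.e. equality holds for some such pair $f$, $g=J[f]$.
   Context: $\mathbb{D}=\{z\in\mathbb{C}:|z|<1\}$. $\mathcal{A}$ is the class of analytic functions $f$ on $\mathbb{D}$ with $f(0)=0$ and $f'(0)=1$. For $F,G$ analytic on $\mathbb{D}$, $F\prec G$ ($F$ is subordinate to $G$) means there is an analytic $\omega:\mathbb{D}\to\mathbb{D}$ with $\omega(0)=0$ and $F(z)=G(\omega(z))$ for all $z\in\mathbb{D}$. For $0<\lambda\le\pi/2$, $$\mathcal{S}^*_{\lambda e}=\left\{f\in\mathcal{A}:\frac{zf'(z)}{f(z)}\prec e^{\lambda z}\right\},\qquad \mathcal{C}_{\lambda e}=\left\{f\in\mathcal{A}:1+\frac{zf''(z)}{f'(z)}\prec e^{\lambda z}\right\},$$ where $zf'(z)/f(z)$ is understood to take the value $1$ at $z=0$. The Alexander transformation of $f\in\mathcal{A}$ is $J[f](z)=\int_0^z\frac{f(t)}{t}\,dt$; one has $f\in\mathcal{S}^*_{\lambda e}$ if and only if $J[f]\in\mathcal{C}_{\lambda e}$. For a locally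 univalent analytic $f$ on $\mathbb{D}$ (i.e. $f'(z)\neq0$ for all $z\in\mathbb{D}$), $P_f(z)=f''(z)/f'(z)$ is the pre-Schwarzian derivative and $\|P_f\|=\sup_{z\in\mathbb{D}}(1-|z|^2)|P_f(z)|$ is the pre-Schwarzian norm. *)

theory Defs
  imports "HOL-Complex_Analysis.Complex_Analysis"
begin

abbreviation unit_disc :: "complex set" ("\<D>")
  where "\<D> \<equiv> ball 0 1"

definition class_A :: "(complex \<Rightarrow> complex) set"
  where "class_A = {f. f holomorphic_on \<D> \<and> f 0 = 0 \<and> deriv f 0 = 1}"

definition subordinate :: "(complex \<Rightarrow> complex) \<Rightarrow> (complex \<Rightarrow> complex) \<Rightarrow> bool"
  (infix "\<prec>\<^sub>s" 50)
  where "F \<prec>\<^sub>s G \<longleftrightarrow> F holomorphic_on \<D> \<and> G holomorphic_on \<D> \<and>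
    (\<exists>\<omega>. \<omega> holomorphic_on \<D> \<and> \<omega> ` \<D> \<subseteq> \<D> \<and> \<omega> 0 = 0 \<and> (\<forall>z\<in>\<D>. F z = G (\<omega> z)))"

text \<open>
  In the two classes below, the quotients are analytic only where their denominators do not vanish.
  Since HOL division is total (with \<open>x / 0 = 0\<close>), the nonvanishing conditions that are implicit
  in writing the quotients are stated explicitly.
\<close>

definition starlike_exp :: "real \<Rightarrow> (complex \<Rightarrow> complex) set"
  where "starlike_exp l = {f \<in> class_A. (\<forall>z\<in>\<D> - {0}. f z \<noteq> 0) \<and>
    (\<lambda>z. if z = 0 then 1 else z * deriv f z / f z) \<prec>\<^sub>s (\<lambda>z. exp (of_real l * z))}"

definition convex_exp :: "real \<Rightarrow> (complex \<Rightarrow> complex) set"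
  where "convex_exp l = {f \<in> class_A. (\<forall>z\<in>\<D>. deriv f z \<noteq> 0) \<and>
    (\<lambda>z. 1 + z * deriv (deriv f) z / deriv f z) \<prec>\<^sub>s (\<lambda>z. exp (of_real l * z))}"

text \<open>
  The integral is taken along the segment from \<open>0\<close> to \<open>z\<close>; the value of the integrand at the single
  point \<open>t = 0\<close> does not affect it.
\<close>

definition alexander :: "(complex \<Rightarrow> complex) \<Rightarrow> complex \<Rightarrow> complex"
  where "alexander f z = contour_integral (linepath 0 z) (\<lambda>t. f t / t)"

definition pre_schwarzian :: "(complex \<Rightarrow> complex) \<Rightarrow> complex \<Rightarrow> complex"
  where "pre_schwarzian f z = deriv (deriv f) z / deriv f z"

text \<open>
  The supremum is taken in the extended reals, so that it is \<open>\<infinity>\<close> (and not an unspecified real)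
  when the set is unbounded.
\<close>

definition pre_schwarzian_norm :: "(complex \<Rightarrow> complex) \<Rightarrow> ereal"
  where "pre_schwarzian_norm f =
    (SUP z\<in>\<D>. ereal ((1 - (cmod z)\<^sup>2) * cmod (pre_schwarzian f z)))"

end

(* A convex function g of exponential type satisfies 1 + z g''/g' = exp(l w(z)) with a Schwarz
   function w, so |z P_g(z)| <= exp(l|z|) - 1 by the Schwarz lemma and |exp u - 1| <= exp|u| - 1.
   Hence the norm is at most the maximum over 0 < r < 1 of h(r) = (1 - r^2)(exp(l r) - 1)/r, and
   w(z) = z attains it, since then equality holds on the positive radius. Here h'(r) = k(r)/r^2,
   where k is the function in the root equation. Since k(r)/r^2 is strictly decreasing as long as
   l^2 <= 6, the root is unique and is the maximum point of h. *)
theory Submission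
  imports Defs
begin

section \<open>The root equation and the maximum of the radial profile\<close>

definition crit :: "real \<Rightarrow> real \<Rightarrow> real"
  where "crit l r = l * r * exp (l * r) * (1 - r\<^sup>2) - (1 + r\<^sup>2) * (exp (l * r) - 1)"

definition profile :: "real \<Rightarrow> real \<Rightarrow> real"
  where "profile l r = (1 - r\<^sup>2) * (exp (l * r) - 1) / r"

text \<open>The derivative of \<open>crit l\<close> with one factor r split off. Its value at 0 is
  l^2, whereas the derivative itself vanishes there.\<close>

definition crit_slope :: "real \<Rightarrow> real \<Rightarrow> real"
  where "crit_slope l r = exp (l * r) * (l\<^sup>2 * (1 - r\<^sup>2) - 4 * l * r - 2) + 2"

lemma crit_DERIV: "(crit l has_real_derivative r * crit_slope l r) (at r)"
  unfolding crit_def[abs_def] crit_slope_def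
  by (auto intro!: derivative_eq_intros simp: algebra_simps power2_eq_square)

lemma crit_slope_DERIV:
  "(crit_slope l has_real_derivative l * exp (l * r) * (l\<^sup>2 * (1 - r\<^sup>2) - 6 * l * r - 6)) (at r)"
  unfolding crit_slope_def[abs_def]
  by (auto intro!: derivative_eq_intros simp: algebra_simps power2_eq_square power3_eq_cube)

text \<open>The expression is r^3 times the derivative of \<open>crit l r / r\<^sup>2\<close>. It
  vanishes at 0, and in its own derivative the terms with \<open>crit_slope\<close> cancel. What
  remains is r^2 times the derivative of \<open>crit_slope\<close>, which is negative because l^2 <=
  6.\<close>

lemma crit_auxiliary_neg:
  assumes l: "0 < l" "l\<^sup>2 \<le> 6" and r: "0 < r"
  shows "r\<^sup>2 * crit_slope l r - 2 * crit l r < 0"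
proof -
  let ?m = "\<lambda>r. r\<^sup>2 * crit_slope l r - 2 * crit l r"
  let ?d = "\<lambda>r. l * exp (l * r) * (l\<^sup>2 * (1 - r\<^sup>2) - 6 * l * r - 6)"
  have m: "(?m has_real_derivative x\<^sup>2 * ?d x) (at x)" for x
    by (rule derivative_eq_intros crit_DERIV crit_slope_DERIV refl)+ (simp add: algebra_simps power2_eq_square)
  have "x\<^sup>2 * ?d x < 0" if x: "0 < x" for x
  proof -
    have "l\<^sup>2 * (1 - x\<^sup>2) \<le> l\<^sup>2" using x by (simp add: algebra_simps)
    moreover have "0 < 6 * l * x" using l x by simp
    ultimately have "l\<^sup>2 * (1 - x\<^sup>2) - 6 * l * x - 6 < 0" using l(2) by linarith
    with l x show ?thesis by (intro mult_pos_neg) auto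
  qed
  moreover have "continuous_on {0..r} ?m"
    using m by (intro DERIV_continuous_on) (auto intro: has_field_derivative_at_within)
  ultimately have "?m r < ?m 0"
    by (intro DERIV_neg_imp_decreasing_open[OF r]) (rule exI, rule conjI, rule m, simp_all only:)
  then show ?thesis by (simp add: crit_def)
qed

text \<open>In the power series of \<open>crit l r\<close> the coefficient of \<open>r^n\<close> is
  \<open>(n - 1) l^(n - 2) (l\<^sup>2 - n (n - 1)) / n!\<close> for \<open>n \<ge> 3\<close>, which is negative for \<open>l\<^sup>2 < 6\<close>; this is why dividing
  by \<open>r\<^sup>2\<close> yields a monotone function.\<close>

lemma crit_ratio_decreasing:
  assumes l: "0 < l" "l\<^sup>2 \<le> 6" and ab: "0 < a" "a < b"
  shows "crit l b / b\<^sup>2 < crit l a / a\<^sup>2"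
proof (rule DERIV_neg_imp_decreasing[OF ab(2)])
  fix x assume "a \<le> x" "x \<le> b"
  with ab have x: "0 < x" by simp
  have "((\<lambda>r. crit l r / r\<^sup>2) has_real_derivative (x\<^sup>2 * crit_slope l x - 2 * crit l x) / x ^ 3) (at x)"
    using x by (auto intro!: derivative_eq_intros crit_DERIV
        simp: field_simps power2_eq_square power3_eq_cube)
  moreover have "(x\<^sup>2 * crit_slope l x - 2 * crit l x) / x ^ 3 < 0"
    using crit_auxiliary_neg[OF l x] x by (simp add: divide_neg_pos)
  ultimately show "\<exists>y. ((\<lambda>r. crit l r / r\<^sup>2) has_real_derivative y) (at x) \<and> y < 0" by blast
qed

text \<open>The strictly decreasing quotient \<open>crit l r / r\<^sup>2\<close> has the sign of
  \<open>crit l r\<close> and passes through 0 at \<alpha>.\<close>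

lemma crit_sign:
  assumes "0 < l" "l\<^sup>2 \<le> 6" "0 < \<alpha>" "crit l \<alpha> = 0"
  shows "0 < r \<Longrightarrow> r < \<alpha> \<Longrightarrow> 0 < crit l r" and "\<alpha> < r \<Longrightarrow> crit l r < 0"
  using crit_ratio_decreasing[OF assms(1,2), of r \<alpha>] crit_ratio_decreasing[OF assms(1,2), of \<alpha> r] assms
  by (auto simp: zero_less_divide_iff divide_less_0_iff)

text \<open>Both \<open>crit l\<close> and its derivative vanish at 0, so the sign comes from second
  order: \<open>crit_slope l 0\<close> is l^2 > 0 and stays positive nearby by continuity.\<close>

lemma crit_pos_near_0:
  assumes "0 < l"
  obtains r where "0 < r" "r < 1" "0 < crit l r"
proof -
  have "isCont (crit_slope l) 0"
    using crit_slope_DERIV by (rule DERIV_isCont)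
  moreover have "0 < crit_slope l 0"
    using assms by (simp add: crit_slope_def)
  ultimately have "eventually (\<lambda>x. 0 < crit_slope l x) (at 0)"
    unfolding isCont_def by (rule order_tendstoD)
  then obtain d where d: "d > 0" "\<And>x. x \<noteq> 0 \<Longrightarrow> \<bar>x\<bar> < d \<Longrightarrow> 0 < crit_slope l x"
    unfolding eventually_at by (auto simp: dist_real_def)
  define r where "r = min d 1 / 2"
  have r: "0 < r" "r < d" "r < 1" using d by (auto simp: r_def)
  have "crit l 0 < crit l r"
  proof (rule DERIV_pos_imp_increasing_open[OF r(1)])
    fix x assume "0 < x" "x < r"
    then have "0 < x * crit_slope l x" using d r by simp
    then show "\<exists>y. (crit l has_real_derivative y) (at x) \<and> 0 < y" using crit_DERIV by blast
  qed (use crit_DERIV in \<open>auto intro!: DERIV_continuous_on intro: has_field_derivative_at_within\<close>)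
  with r show ?thesis by (intro that) (auto simp: crit_def)
qed

lemma crit_unique_root:
  assumes "0 < l" "l\<^sup>2 \<le> 6"
  shows "\<exists>!\<alpha>. 0 < \<alpha> \<and> \<alpha> < 1 \<and> crit l \<alpha> = 0"
proof -
  obtain r where r: "0 < r" "r < 1" "0 < crit l r"
    using assms crit_pos_near_0 by blast
  \<comment> \<open>At r = 1 the first summand drops out and -2 (exp l - 1) is left, which gives the
    sign change for the intermediate value theorem.\<close>
  have neg: "crit l 1 < 0" using assms by (simp add: crit_def)
  obtain \<alpha> where \<alpha>: "r \<le> \<alpha>" "\<alpha> \<le> 1" "crit l \<alpha> = 0"
  proof -
    have "\<exists>x\<ge>r. x \<le> 1 \<and> crit l x = 0"
      using r neg crit_DERIV by (intro IVT2) (auto intro: DERIV_isCont)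
    then show ?thesis using that by blast
  qed
  with neg have "\<alpha> < 1" by (metis less_eq_real_def less_irrefl)
  moreover have "\<beta> = \<alpha>" if "0 < \<beta>" "crit l \<beta> = 0" for \<beta>
    using crit_sign[OF assms, of \<alpha> \<beta>] that r \<alpha> by (cases \<beta> \<alpha> rule: linorder_cases) auto
  ultimately show ?thesis using r \<alpha> by (intro ex1I[of _ \<alpha>]) auto
qed

lemma profile_DERIV:
  assumes "r \<noteq> 0"
  shows "(profile l has_real_derivative crit l r / r\<^sup>2) (at r)"
  using assms unfolding profile_def[abs_def] crit_def
  by (auto intro!: derivative_eq_intros simp: field_simps power2_eq_square)

text \<open>The derivative of the profile has the sign of \<open>crit\<close>, so the profile rises
  up to \<alpha> and falls afterwards.\<close>

lemma profile_le:
  assumes l: "0 < l" "l\<^sup>2 \<le> 6" and \<alpha>: "0 < \<alpha>" "crit l \<alpha> = 0" and r: "0 < r"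
  shows "profile l r \<le> profile l \<alpha>"
proof (cases "r \<le> \<alpha>")
  case True
  then show ?thesis
  proof (rule DERIV_nonneg_imp_nondecreasing)
    fix x assume x: "r \<le> x" "x \<le> \<alpha>"
    then have "0 \<le> crit l x / x\<^sup>2" using crit_sign(1)[OF l \<alpha>, of x] \<alpha> r by (cases "x = \<alpha>") auto
    then show "\<exists>y. (profile l has_real_derivative y) (at x) \<and> 0 \<le> y"
      using profile_DERIV[of x l] r x by auto
  qed
next
  case False
  then have "\<alpha> \<le> r" by simp
  then show ?thesis
  proof (rule DERIV_nonpos_imp_nonincreasing)
    fix x assume x: "\<alpha> \<le> x" "x \<le> r"
    then have "crit l x / x\<^sup>2 \<le> 0"
      using crit_sign(2)[OF l \<alpha>, of x] \<alpha> by (cases "x = \<alpha>") (auto simp: divide_nonpos_pos)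
    then show "\<exists>y. (profile l has_real_derivative y) (at x) \<and> y \<le> 0"
      using profile_DERIV[of x l] \<alpha> x by auto
  qed
qed

section \<open>The upper bound for the pre-Schwarzian norm\<close>

text \<open>Without its constant term the exponential series has only positive coefficients, so the
  triangle inequality applies termwise.\<close>

lemma norm_exp_minus_1_le:
  fixes w :: "'a::{real_normed_field,banach}"
  shows "norm (exp w - 1) \<le> exp (norm w) - 1"
proof -
  have "norm (exp w - 1) = norm (\<Sum>n. inverse (fact (Suc n)) *\<^sub>R w ^ Suc n)"
    by (subst exp_first_term) simp
  also have "\<dots> \<le> (\<Sum>n. inverse (fact (Suc n)) *\<^sub>R norm w ^ Suc n)"
  proof (rule norm_suminf_le)
    show "summable (\<lambda>n. inverse (fact (Suc n)) *\<^sub>R norm w ^ Suc n)"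
      using summable_exp_generic[of "norm w"] by (subst summable_Suc_iff) simp
  qed (simp add: norm_power norm_mult)
  also have "\<dots> = exp (norm w) - 1"
    using exp_first_term[of "norm w"] by linarith
  finally show ?thesis .
qed

text \<open>Derivatives at a point of the open disc depend only on values nearby. This transfers the
  norm between g and \<open>alexander f\<close>, whose equality is given on the disc alone.\<close>

lemma pre_schwarzian_norm_cong:
  assumes "\<And>z. z \<in> \<D> \<Longrightarrow> f z = g z"
  shows "pre_schwarzian_norm f = pre_schwarzian_norm g"
proof -
  have D: "deriv F z = deriv G z" if "\<And>z. z \<in> \<D> \<Longrightarrow> F z = G z" "z \<in> \<D>" for F G z
    using that by (intro deriv_cong_ev eventually_nhds_in_open[THEN eventually_mono, of \<D>]) auto
  have "deriv f z = deriv g z" if "z \<in> \<D>" for z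
    using D[OF assms that] .
  moreover from this have "deriv (deriv f) z = deriv (deriv g) z" if "z \<in> \<D>" for z
    using D[of "deriv f" "deriv g"] that by blast
  ultimately show ?thesis
    unfolding pre_schwarzian_norm_def pre_schwarzian_def by (intro SUP_cong) auto
qed

text \<open>The origin is left out: there the subordination reads 1 = 1, and
  \<open>profile l 0\<close> is 0 by the convention for division by zero.\<close>

lemma convex_exp_pre_schwarzian_le_profile:
  assumes g: "g \<in> convex_exp l" and l: "0 < l" and z: "z \<in> \<D>" "z \<noteq> 0"
  shows "(1 - (cmod z)\<^sup>2) * cmod (pre_schwarzian g z) \<le> profile l (cmod z)"
proof -
  obtain \<omega> where \<omega>: "\<omega> holomorphic_on \<D>" "\<omega> ` \<D> \<subseteq> \<D>" "\<omega> 0 = 0"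
    and sub: "\<And>z. z \<in> \<D> \<Longrightarrow> 1 + z * deriv (deriv g) z / deriv g z = exp (of_real l * \<omega> z)"
    using g unfolding convex_exp_def subordinate_def by blast
  have "cmod (\<omega> z) \<le> cmod z"
    using \<omega> z by (intro Schwarz_Lemma(1)) (auto simp: image_subset_iff)
  then have le: "exp (l * cmod (\<omega> z)) \<le> exp (l * cmod z)"
    using l by simp
  have "z * pre_schwarzian g z = exp (of_real l * \<omega> z) - 1"
    using sub[OF z(1)] unfolding pre_schwarzian_def by (simp add: algebra_simps)
  moreover have "cmod (of_real l * \<omega> z) = l * cmod (\<omega> z)"
    using l by (simp add: norm_mult)
  ultimately have "cmod (z * pre_schwarzian g z) \<le> exp (l * cmod (\<omega> z)) - 1"
    using norm_exp_minus_1_le[of "of_real l * \<omega> z"] by simp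
  then have "cmod z * cmod (pre_schwarzian g z) \<le> exp (l * cmod (\<omega> z)) - 1"
    by (simp add: norm_mult)
  with le have "cmod z * cmod (pre_schwarzian g z) \<le> exp (l * cmod z) - 1"
    by linarith
  with z have "cmod (pre_schwarzian g z) \<le> (exp (l * cmod z) - 1) / cmod z"
    by (simp add: field_simps)
  moreover have "0 \<le> 1 - (cmod z)\<^sup>2"
    using z by (simp add: power_le_one)
  ultimately have "(1 - (cmod z)\<^sup>2) * cmod (pre_schwarzian g z)
      \<le> (1 - (cmod z)\<^sup>2) * ((exp (l * cmod z) - 1) / cmod z)"
    by (rule mult_left_mono)
  then show ?thesis by (simp add: profile_def)
qed

lemma pre_schwarzian_norm_convex_exp_le:
  assumes g: "g \<in> convex_exp l" and l: "0 < l" "l\<^sup>2 \<le> 6" and \<alpha>: "0 < \<alpha>" "crit l \<alpha> = 0"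
  shows "pre_schwarzian_norm g \<le> ereal (profile l \<alpha>)"
proof -
  let ?W = "\<lambda>z. (1 - (cmod z)\<^sup>2) * cmod (pre_schwarzian g z)"
  have punctured: "?W z \<le> profile l \<alpha>" if "z \<in> \<D>" "z \<noteq> 0" for z
    using convex_exp_pre_schwarzian_le_profile[OF g l(1) that] profile_le[OF l \<alpha>, of "cmod z"] that
    by simp
  \<comment> \<open>At the origin the bound is the limit of the bound on the punctured disc, since
    \<open>pre_schwarzian g\<close> is continuous there.\<close>
  have center: "?W 0 \<le> profile l \<alpha>"
  proof (rule tendsto_upperbound)
    have "g holomorphic_on \<D>" "\<forall>z\<in>\<D>. deriv g z \<noteq> 0"
      using g by (auto simp: convex_exp_def class_A_def)
    then have "pre_schwarzian g holomorphic_on \<D>"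
      unfolding pre_schwarzian_def[abs_def] by (intro holomorphic_intros) auto
    then have "isCont (pre_schwarzian g) 0"
      by (intro continuous_on_interior[OF holomorphic_on_imp_continuous_on]) auto
    then have "isCont ?W 0"
      by (intro continuous_intros) auto
    then show "(?W \<longlongrightarrow> ?W 0) (at 0)"
      by (rule isContD)
    show "\<forall>\<^sub>F z in at 0. ?W z \<le> profile l \<alpha>"
      using eventually_at_in_open[of \<D> 0] by (rule eventually_mono) (auto intro: punctured)
  qed simp
  show ?thesis
    unfolding pre_schwarzian_norm_def using punctured center by (intro SUP_least) (metis ereal_less_eq(3))
qed

section \<open>The extremal pair\<close>

text \<open>Taking the Schwarz function to be the identity forces g''/g' = q with z q(z) = exp(l z)
  - 1. Two integrations give g' = p = exp(E0 - E0(0)) and then g. With f = z p, the product rule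
  gives f' = p (1 + z q) = p exp(l z), so z f'/f = exp(l z).\<close>

lemma extremal_pair:
  fixes l :: real
  obtains f g where "f \<in> starlike_exp l" "g \<in> convex_exp l"
    "\<And>z. z \<in> \<D> \<Longrightarrow> g z = alexander f z"
    "\<And>z. z \<in> \<D> \<Longrightarrow> z \<noteq> 0 \<Longrightarrow> pre_schwarzian g z = (exp (of_real l * z) - 1) / z"
proof -
  let ?e = "\<lambda>z. exp (of_real l * z) :: complex"
  \<comment> \<open>The value at 0 removes the singularity, so that q has a primitive on the whole
    disc.\<close>
  define q where "q z = (if z = 0 then deriv ?e 0 else (?e z - ?e 0) / (z - 0))" for z
  have q: "z * q z = ?e z - 1" for z by (simp add: q_def)
  have "q holomorphic_on \<D>"
    unfolding q_def[abs_def] by (intro pole_lemma_open holomorphic_intros) auto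
  then obtain E0 where E0: "\<And>z. z \<in> \<D> \<Longrightarrow> (E0 has_field_derivative q z) (at z)"
    by (rule holomorphic_convex_primitive'[rotated 2]) (auto simp: at_within_open[of _ \<D>])
  \<comment> \<open>Subtracting \<open>E0 0\<close> makes p(0) = 1, which becomes the normalisation
    g'(0) = f'(0) = 1.\<close>
  define p where "p z = exp (E0 z - E0 0)" for z
  have p: "(p has_field_derivative p z * q z) (at z)" if "z \<in> \<D>" for z
    unfolding p_def[abs_def] using E0[OF that] by (auto intro!: derivative_eq_intros)
  have p_nz: "p z \<noteq> 0" for z by (simp add: p_def)
  have p0: "p 0 = 1" by (simp add: p_def)
  have "p holomorphic_on \<D>"
    using p by (meson holomorphic_on_open open_ball)
  then obtain G0 where G0: "\<And>z. z \<in> \<D> \<Longrightarrow> (G0 has_field_derivative p z) (at z)"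
    by (rule holomorphic_convex_primitive'[rotated 2]) (auto simp: at_within_open[of _ \<D>])
  define g where "g z = G0 z - G0 0" for z
  define f where "f z = z * p z" for z
  have g: "(g has_field_derivative p z) (at z)" if "z \<in> \<D>" for z
    unfolding g_def[abs_def] using G0[OF that] by (auto intro!: derivative_eq_intros)
  have f: "(f has_field_derivative p z * ?e z) (at z)" if "z \<in> \<D>" for z
  proof -
    have "(f has_field_derivative 1 * p z + p z * q z * z) (at z)"
      unfolding f_def[abs_def] using p[OF that] by (intro DERIV_mult DERIV_ident)
    moreover have "1 * p z + p z * q z * z = p z * (1 + z * q z)" by (simp add: algebra_simps)
    ultimately show ?thesis by (simp add: q)
  qed
  have g': "deriv g z = p z" if "z \<in> \<D>" for z
    using g[OF that] by (rule DERIV_imp_deriv)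
  have g'': "deriv (deriv g) z = p z * q z" if "z \<in> \<D>" for z
    using has_field_derivative_transform_within_open[OF p[OF that], of \<D> "deriv g"] that g'
    by (intro DERIV_imp_deriv) auto
  have f': "deriv f z = p z * ?e z" if "z \<in> \<D>" for z
    using f[OF that] by (rule DERIV_imp_deriv)
  have "f holomorphic_on \<D>" "g holomorphic_on \<D>"
    using f g by (meson holomorphic_on_open open_ball)+
  then have A: "f \<in> class_A" "g \<in> class_A"
    by (auto simp: class_A_def f' g' p0 f_def g_def)
  have sub: "F \<prec>\<^sub>s ?e" if "\<And>z. z \<in> \<D> \<Longrightarrow> F z = ?e z" for F
  proof -
    have e: "?e holomorphic_on \<D>" by (intro holomorphic_intros)
    then have "F holomorphic_on \<D>" by (rule holomorphic_transform) (simp add: that)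
    with e that show ?thesis unfolding subordinate_def by (intro conjI exI[of _ "\<lambda>z. z"]) auto
  qed
  have "f \<in> starlike_exp l"
    unfolding starlike_exp_def using A p_nz by (auto intro!: sub simp: f' f_def)
  moreover have "g \<in> convex_exp l"
    unfolding convex_exp_def using A p_nz by (auto intro!: sub simp: g' g'' q)
  moreover have "g z = alexander f z" if z: "z \<in> \<D>" for z
  proof -
    have seg: "closed_segment 0 z \<subseteq> \<D>"
      using z by (intro closed_segment_subset) auto
    have "(p has_contour_integral g (pathfinish (linepath 0 z)) - g (pathstart (linepath 0 z))) (linepath 0 z)"
    proof (rule contour_integral_primitive[of \<D>])
      show "(g has_field_derivative p w) (at w within \<D>)" if "w \<in> \<D>" for w
        using g[OF that] by (rule has_field_derivative_at_within)
    qed (use seg in \<open>simp_all only: valid_path_linepath path_image_linepath\<close>)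
    then have "(p has_contour_integral g z) (linepath 0 z)"
      by (simp add: g_def)
    then have "((\<lambda>x. p (linepath 0 z x) * (z - 0)) has_integral g z) {0..1}"
      by (simp add: has_contour_integral_linepath)
    \<comment> \<open>For z \<noteq> 0 the integrands differ only at parameter 0, where f(t)/t is
      0/0 = 0 but p is 1. For z = 0 the factor \<open>z - 0\<close> makes both vanish.\<close>
    then have "((\<lambda>x. f (linepath 0 z x) / linepath 0 z x * (z - 0)) has_integral g z) {0..1}"
      by (rule has_integral_spike_finite[of "{0}", rotated 2]) (auto simp: f_def linepath_def scaleR_conv_of_real)
    then have "((\<lambda>t. f t / t) has_contour_integral g z) (linepath 0 z)"
      by (simp add: has_contour_integral_linepath)
    then show ?thesis
      unfolding alexander_def by (metis contour_integral_unique)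
  qed
  moreover have "pre_schwarzian g z = (?e z - 1) / z" if "z \<in> \<D>" "z \<noteq> 0" for z
    using that p_nz q[of z] by (simp add: pre_schwarzian_def g' g'' field_simps)
  ultimately show ?thesis by (rule that)
qed

theorem theorem2p3:
  fixes l :: real
  assumes "0 < l" and "l \<le> pi / 2"
  defines "is_root \<equiv> \<lambda>r::real. 0 < r \<and> r < 1 \<and>
      l * r * exp (l * r) * (1 - r\<^sup>2) - (1 + r\<^sup>2) * (exp (l * r) - 1) = 0"
  shows "(\<exists>!\<alpha>. is_root \<alpha>) \<and>
    (\<forall>\<alpha>. is_root \<alpha> \<longrightarrow>
      (\<forall>f g. f \<in> starlike_exp l \<and> g \<in> convex_exp l \<and> (\<forall>z\<in>\<D>. g z = alexander f z) \<longrightarrow>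
         pre_schwarzian_norm g = pre_schwarzian_norm (alexander f) \<and>
         pre_schwarzian_norm (alexander f) \<le> ereal ((1 - \<alpha>\<^sup>2) * (exp (l * \<alpha>) - 1) / \<alpha>)) \<and>
      (\<exists>f g. f \<in> starlike_exp l \<and> g \<in> convex_exp l \<and> (\<forall>z\<in>\<D>. g z = alexander f z) \<and>
         pre_schwarzian_norm g = ereal ((1 - \<alpha>\<^sup>2) * (exp (l * \<alpha>) - 1) / \<alpha>)))"
proof -
  \<comment> \<open>From pi < 4 follows l <= 2, hence l^2 <= 4, which is within the bound 6 that the
    monotonicity argument asks for.\<close>
  have "l\<^sup>2 \<le> 2\<^sup>2"
    using assms(1,2) pi_less_4 by (intro power_mono) auto
  then have l: "0 < l" "l\<^sup>2 \<le> 6" using assms(1) by auto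
  have is_root: "is_root = (\<lambda>\<alpha>. 0 < \<alpha> \<and> \<alpha> < 1 \<and> crit l \<alpha> = 0)"
    by (simp add: is_root_def crit_def)
  have upper: "pre_schwarzian_norm g \<le> ereal (profile l \<alpha>)" if "is_root \<alpha>" "g \<in> convex_exp l" for g \<alpha>
    using pre_schwarzian_norm_convex_exp_le[OF that(2) l] that(1) by (auto simp: is_root)
  have attained: "\<exists>f g. f \<in> starlike_exp l \<and> g \<in> convex_exp l \<and> (\<forall>z\<in>\<D>. g z = alexander f z) \<and>
      pre_schwarzian_norm g = ereal (profile l \<alpha>)" if \<alpha>: "is_root \<alpha>" for \<alpha>
  proof -
    have r: "0 < \<alpha>" "\<alpha> < 1" using \<alpha> by (auto simp: is_root)
    obtain f g where fg: "f \<in> starlike_exp l" "g \<in> convex_exp l" "\<And>z. z \<in> \<D> \<Longrightarrow> g z = alexander f z"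
      and P: "\<And>z. z \<in> \<D> \<Longrightarrow> z \<noteq> 0 \<Longrightarrow> pre_schwarzian g z = (exp (of_real l * z) - 1) / z"
      using extremal_pair[of l] by blast
    \<comment> \<open>On the positive radius the quotient is real and nonnegative, so the modulus
      loses nothing. The single point z = \<alpha> then bounds the supremum from below by the
      profile at \<alpha>.\<close>
    have "pre_schwarzian g (of_real \<alpha>) = of_real ((exp (l * \<alpha>) - 1) / \<alpha>)"
      using P[of "of_real \<alpha>"] r by (simp flip: exp_of_real)
    moreover have "0 \<le> (exp (l * \<alpha>) - 1) / \<alpha>" using r l by simp
    ultimately have "cmod (pre_schwarzian g (of_real \<alpha>)) = (exp (l * \<alpha>) - 1) / \<alpha>"
      by (simp only: norm_of_real abs_of_nonneg)
    then have "ereal (profile l \<alpha>) = ereal ((1 - (cmod (of_real \<alpha>))\<^sup>2) * cmod (pre_schwarzian g (of_real \<alpha>)))"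
      by (simp add: profile_def)
    also have "\<dots> \<le> pre_schwarzian_norm g"
      unfolding pre_schwarzian_norm_def using r by (intro SUP_upper) simp
    finally have "pre_schwarzian_norm g = ereal (profile l \<alpha>)"
      using upper[OF \<alpha> fg(2)] by (rule antisym[rotated])
    with fg show ?thesis by blast
  qed
  have eq: "pre_schwarzian_norm g = pre_schwarzian_norm (alexander f)"
    if "\<forall>z\<in>\<D>. g z = alexander f z" for f g
    using that by (intro pre_schwarzian_norm_cong) blast
  show ?thesis
  proof (fold profile_def, intro conjI allI impI)
    show "\<exists>!\<alpha>. is_root \<alpha>"
      using crit_unique_root[OF l] by (simp add: is_root)
  next
    fix \<alpha> f g
    assume \<alpha>: "is_root \<alpha>"
      and fg: "f \<in> starlike_exp l \<and> g \<in> convex_exp l \<and> (\<forall>z\<in>\<D>. g z = alexander f z)"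
    show *: "pre_schwarzian_norm g = pre_schwarzian_norm (alexander f)"
      using eq fg by blast
    show "pre_schwarzian_norm (alexander f) \<le> ereal (profile l \<alpha>)"
      using upper[OF \<alpha>, of g] fg * by simp
  qed (rule attained)
qed

end
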